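(* Let $A$ be an evolution $K$-algebra over a field $K$ with associated graph $E$ (relative to a natural basis of $A$). If the annihilator stabilizing index $\mathrm{asi}(A)$ is finite, then the absorption radical of $A$ is $$\mathcal{R}_{abs}(A)=\operatorname{span}\Big(\bigcup_{n\ge 1}\mathbb S_n\Big).$$
   Context: Algebras are not assumed associative. An evolution algebra over $K$ is a $K$-algebra $A$ having a basis $B=\{e_i\}_{i\in\Lambda}$ (a natural basis) with $e_ie_j=0$ for all $i\ne j$. Write $e_i^2=\sum_{j\in\Lambda}\omega_{ji}e_j$. The directed graph $E$ associated to $A$ relative to $B$ has vertex set $E^0=\{e_i\}_{i\in\Lambda}$ and exactly one edge from $e_i$ to $e_j$ if $\omega_{ji}\neq 0$, and none otherwise. Absorption radical: an ideal $I$ of a commutative algebra $A$ has the absorption property if $xA\subset I$ implies $x\in I$. $\mathcal R_{abs}(A)$ is the intersection of all ideals of $A$ having the absorption property. Upper annihilating series: $\operatorname{Ann}(A)=\{x\in A: xA=Ax=0\}$, $\operatorname{Ann}^{(1)}(A)=\operatorname{Ann}(A)$, and recursively $\operatorname{Ann}^{(i+1)}(A)$ is the ideal containing $\operatorname{Ann}^{(i)}(A)$ with $\operatorname{Ann}^{(i+1)}(A)/\operatorname{Ann}^{(i)}(A)=\operatorname{Ann}(A/\operatorname{Ann}^{(i)}(A))$, for $i\geq 1$. If there is $q\ge1$ with $\operatorname{Ann}^{(q)}(A)=\operatorname{Ann}^{(q+1)}(A)$, the minimal such $q$ is the annihilator stabilizing index $\mathrm{asi}(A)$ (and then it is finite).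 $n$-sinks: a sink is a vertex which is the source of no edge. A $1$-sink of $E$ is a sink of $E$. For $n>1$, recursively, an $n$-sink is a vertex which is a sink in the graph obtained from $E$ by removing all $i$-sinks with $i<n$ together with all edges having source or range among them. $\mathbb S_n$ is the set of all $n$-sinks of $E$. *)

theory Defs
  imports
    "HOL-Library.Set_Algebras"
    "HOL-Library.Extended_Nat"
    "Graph_Theory.Digraph_Component"
begin

definition annihilator :: "'b set \<Rightarrow> ('b \<Rightarrow> 'b \<Rightarrow> 'b) \<Rightarrow> 'b \<Rightarrow> 'b set" where
  "annihilator C m z = {x \<in> C. \<forall>a\<in>C. m x a = z \<and> m a x = z}"


section \<open>Sinks of a directed graph\<close>

definition sinks :: "('v, 'e) pre_digraph \<Rightarrow> 'v set" where
  "sinks G = {v \<in> verts G. out_arcs G v = {}}"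

text \<open>
  \<open>n_sinks G n\<close> is meaningful for \<open>n \<ge> 1\<close> only; the value at \<open>0\<close> is a dummy.  Passing to the
  induced subgraph on the remaining vertices deletes all arcs whose tail or head is removed.
\<close>

function n_sinks :: "('v, 'e) pre_digraph \<Rightarrow> nat \<Rightarrow> 'v set" where
  "n_sinks G 0 = {}"
| "n_sinks G (Suc 0) = sinks G"
| "n_sinks G (Suc (Suc n)) = sinks (G \<restriction> (verts G - (\<Union>i\<in>{1..Suc n}. n_sinks G i)))"
  by pat_completeness auto
termination by (relation "measure snd") auto


section \<open>Algebras that need not be associative, commutative or unital\<close>

locale nonassoc_algebra = vector_space scale
  for scale :: "'k::field \<Rightarrow> 'a::ab_group_add \<Rightarrow> 'a" (infixr \<open>*s\<close> 75) +
  fixes mult :: "'a \<Rightarrow> 'a \<Rightarrow> 'a" (infixl \<open>\<cdot>\<close> 70)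
  assumes linear_mult_right: "Vector_Spaces.linear scale scale (\<lambda>y. x \<cdot> y)"
    and linear_mult_left: "Vector_Spaces.linear scale scale (\<lambda>x. x \<cdot> y)"
begin

definition algebra_ideal :: "'a set \<Rightarrow> bool" where
  "algebra_ideal I \<longleftrightarrow> subspace I \<and> (\<forall>x\<in>I. \<forall>a. x \<cdot> a \<in> I \<and> a \<cdot> x \<in> I)"

text \<open>
  The elements of \<open>A / I\<close> are the cosets \<open>x +o I = {x + i | i. i \<in> I}\<close>; its zero is the coset \<open>I\<close>.
\<close>

definition quotient_carrier :: "'a set \<Rightarrow> 'a set set" where
  "quotient_carrier I = (\<lambda>x. x +o I) ` UNIV"

text \<open>
  For an ideal \<open>I\<close>, all the cosets in the union below coincide, so that
  \<open>quotient_mult I (x +o I) (y +o I) = (x \<cdot> y) +o I\<close>.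
\<close>

definition quotient_mult :: "'a set \<Rightarrow> 'a set \<Rightarrow> 'a set \<Rightarrow> 'a set" where
  "quotient_mult I X Y = (\<Union>x\<in>X. \<Union>y\<in>Y. (x \<cdot> y) +o I)"

text \<open>
  The upper annihilating series starts at index \<open>1\<close>; the value at \<open>0\<close> is a dummy.
  The definite description is justified by \<open>upper_annihilator_Suc_unique\<close> below.
\<close>

fun upper_annihilator :: "nat \<Rightarrow> 'a set" where
  "upper_annihilator 0 = {0}"
| "upper_annihilator (Suc 0) = annihilator UNIV (\<cdot>) 0"
| "upper_annihilator (Suc (Suc n)) =
    (let I = upper_annihilator (Suc n) in
      (THE J. algebra_ideal J \<and> I \<subseteq> J \<and>
         (\<lambda>x. x +o I) ` J = annihilator (quotient_carrier I) (quotient_mult I) I))"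

text \<open>The annihilator stabilizing index; it is \<open>\<infinity>\<close> if the series never stabilizes.\<close>

definition asi :: enat where
  "asi = (INF q \<in> {q. 1 \<le> q \<and> upper_annihilator q = upper_annihilator (q + 1)}. enat q)"

definition absorption_property :: "'a set \<Rightarrow> bool" where
  "absorption_property I \<longleftrightarrow> (\<forall>x. (\<forall>a. x \<cdot> a \<in> I) \<longrightarrow> x \<in> I)"

definition absorption_radical :: "'a set" where
  "absorption_radical = \<Inter> {I. algebra_ideal I \<and> absorption_property I}"

definition natural_basis :: "'a set \<Rightarrow> bool" where
  "natural_basis B \<longleftrightarrow> independent B \<and> span B = UNIV \<and>
     (\<forall>u\<in>B. \<forall>v\<in>B. u \<noteq> v \<longrightarrow> u \<cdot> v = 0)"

text \<open>
  \<open>representation B (u \<cdot> u) v\<close> is the coefficient of \<open>v\<close> in the expansion of the square of \<open>u\<close>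
  with respect to the basis \<open>B\<close>.
\<close>

definition associated_graph :: "'a set \<Rightarrow> ('a, 'a \<times> 'a) pre_digraph" where
  "associated_graph B =
     \<lparr> verts = B,
       arcs = {(u, v). u \<in> B \<and> v \<in> B \<and> representation B (u \<cdot> u) v \<noteq> 0},
       tail = fst, head = snd \<rparr>"


subsection \<open>The upper annihilating series is well defined\<close>

lemma mult_simps:
  "(x + y) \<cdot> a = x \<cdot> a + y \<cdot> a" "a \<cdot> (x + y) = a \<cdot> x + a \<cdot> y"
  "(c *s x) \<cdot> a = c *s (x \<cdot> a)" "a \<cdot> (c *s x) = c *s (a \<cdot> x)"
  "0 \<cdot> a = 0" "a \<cdot> 0 = 0"
proof -
  interpret r: Vector_Spaces.linear scale scale "\<lambda>y. a \<cdot> y" by (rule linear_mult_right)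
  interpret l: Vector_Spaces.linear scale scale "\<lambda>x. x \<cdot> a" by (rule linear_mult_left)
  show "(x + y) \<cdot> a = x \<cdot> a + y \<cdot> a" "a \<cdot> (x + y) = a \<cdot> x + a \<cdot> y"
    "(c *s x) \<cdot> a = c *s (x \<cdot> a)" "a \<cdot> (c *s x) = c *s (a \<cdot> x)"
    "0 \<cdot> a = 0" "a \<cdot> 0 = 0"
    by (simp_all add: r.add l.add r.scale l.scale r.zero l.zero)
qed

lemma coset_eq_iff:
  assumes "subspace I"
  shows "x +o I = y +o I \<longleftrightarrow> x - y \<in> I"
proof
  assume "x +o I = y +o I"
  moreover have "x \<in> x +o I"
    using subspace_0[OF assms] by (force simp: elt_set_plus_def)
  ultimately show "x - y \<in> I" by (auto simp: elt_set_plus_def)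
next
  assume d: "x - y \<in> I"
  have 1: "u +o I \<subseteq> v +o I" if "u - v \<in> I" for u v
  proof
    fix z assume "z \<in> u +o I"
    then obtain i where "i \<in> I" "z = u + i" by (auto simp: elt_set_plus_def)
    then have "z = v + ((u - v) + i)" "(u - v) + i \<in> I"
      using subspace_add[OF assms that] by auto
    then show "z \<in> v +o I" unfolding elt_set_plus_def by (intro CollectI bexI)
  qed
  have "y - x \<in> I" using subspace_neg[OF assms d] by simp
  with d 1 show "x +o I = y +o I" by blast
qed

lemma quotient_mult_coset:
  assumes "algebra_ideal I"
  shows "quotient_mult I (x +o I) (y +o I) = (x \<cdot> y) +o I"
proof -
  have s: "subspace I" using assms by (simp add: algebra_ideal_def)
  have eq: "u \<cdot> v +o I = (x \<cdot> y) +o I" if uv: "u \<in> x +o I" "v \<in> y +o I" for u v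
  proof -
    obtain i j where ij: "i \<in> I" "u = x + i" "j \<in> I" "v = y + j"
      using uv unfolding elt_set_plus_def by blast
    have "u \<cdot> v - x \<cdot> y = i \<cdot> y + (x \<cdot> j + i \<cdot> j)"
      by (simp add: ij mult_simps algebra_simps)
    moreover have "i \<cdot> y + (x \<cdot> j + i \<cdot> j) \<in> I"
      using assms ij by (auto simp: algebra_ideal_def intro!: subspace_add)
    ultimately show ?thesis using coset_eq_iff[OF s] by simp
  qed
  have "z \<in> z +o I" for z
    using subspace_0[OF s] by (force simp: elt_set_plus_def)
  then have ne: "z +o I \<noteq> {}" for z by blast
  have "quotient_mult I (x +o I) (y +o I) = (\<Union>u\<in>x +o I. \<Union>v\<in>y +o I. (x \<cdot> y) +o I)"
    unfolding quotient_mult_def by (intro SUP_cong refl eq)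
  also have "\<dots> = (x \<cdot> y) +o I" by (simp only: UN_constant ne if_False)
  finally show ?thesis .
qed

lemma upper_annihilator_Suc_unique:
  assumes "algebra_ideal I"
  shows "(algebra_ideal J \<and> I \<subseteq> J \<and>
          (\<lambda>x. x +o I) ` J = annihilator (quotient_carrier I) (quotient_mult I) I) \<longleftrightarrow>
         J = {x. \<forall>a. x \<cdot> a \<in> I \<and> a \<cdot> x \<in> I}" (is "?L J \<longleftrightarrow> J = ?S")
proof -
  have s: "subspace I" using assms by (simp add: algebra_ideal_def)
  have zero: "x +o I = I \<longleftrightarrow> x \<in> I" for x
    using coset_eq_iff[OF s, of x 0] by simp
  have ann: "annihilator (quotient_carrier I) (quotient_mult I) I = (\<lambda>x. x +o I) ` ?S"
  proof -
    have "x +o I \<in> annihilator (quotient_carrier I) (quotient_mult I) I \<longleftrightarrow> x \<in> ?S" for x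
      by (simp add: annihilator_def quotient_carrier_def quotient_mult_coset[OF assms] zero)
    moreover have "annihilator (quotient_carrier I) (quotient_mult I) I \<subseteq> range (\<lambda>x. x +o I)"
      by (auto simp: annihilator_def quotient_carrier_def)
    ultimately show ?thesis by fast
  qed
  have IS: "I \<subseteq> ?S" using assms by (auto simp: algebra_ideal_def)
  have sS: "subspace ?S"
    using s by (auto simp: subspace_def mult_simps)
  have "algebra_ideal ?S"
    using sS IS by (auto simp: algebra_ideal_def)
  then have S: "?L ?S" using ann IS by simp
  have "J = J'" if "?L J" "?L J'" for J J'
  proof -
    have sub: "M \<subseteq> N" if "?L M" "?L N" for M N
    proof
      fix x assume "x \<in> M"
      then have "x +o I \<in> (\<lambda>x. x +o I) ` N" using that by auto
      then obtain y where y: "y \<in> N" "x +o I = y +o I" by auto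
      then have "x - y \<in> N" using coset_eq_iff[OF s] that by auto
      then have "(x - y) + y \<in> N"
        using that y by (intro subspace_add) (auto simp: algebra_ideal_def)
      then show "x \<in> N" by simp
    qed
    show ?thesis by (rule equalityI[OF sub[OF that] sub[OF that(2) that(1)]])
  qed
  from this[OF _ S] S show ?thesis by (intro iffI) (assumption, erule ssubst, assumption)
qed

lemma algebra_ideal_upper_annihilator: "algebra_ideal (upper_annihilator n)"
proof (induction n rule: upper_annihilator.induct)
  case 1
  show ?case by (simp add: algebra_ideal_def subspace_def mult_simps)
next
  case 2
  show ?case by (auto simp: algebra_ideal_def subspace_def mult_simps annihilator_def)
next
  case (3 n)
  then show ?case
    using upper_annihilator_Suc_unique[OF 3]
    by (simp add: Let_def) metis
qed

lemma upper_annihilator_Suc_Suc: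
  "upper_annihilator (Suc (Suc n)) =
     {x. \<forall>a. x \<cdot> a \<in> upper_annihilator (Suc n) \<and> a \<cdot> x \<in> upper_annihilator (Suc n)}"
  by (simp add: Let_def upper_annihilator_Suc_unique[OF algebra_ideal_upper_annihilator])

end

end

theory Submission
  imports Defs
begin

text \<open>
  Each term of the upper annihilating series lies in every ideal \<open>J\<close> with the absorption
  property: if \<open>x\<close> multiplies \<open>A\<close> into a term contained in \<open>J\<close>, then \<open>x\<close> multiplies \<open>A\<close> into
  \<open>J\<close>, hence \<open>x \<in> J\<close>.  Conversely, in a commutative algebra a term that equals its successor is
  itself an ideal with the absorption property.  So if the series stabilizes, its stable term is
  the absorption radical.

  For an evolution algebra the terms can be read off from the graph.  If \<open>x\<close> has coordinates \<open>x\<^sub>b\<close>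
  in the natural basis, then \<open>x \<cdot> b = x\<^sub>b *s (b \<cdot> b)\<close>.  Hence \<open>x\<close> multiplies \<open>A\<close> into the span of a
  set \<open>S\<close> of basis vectors iff each \<open>b\<close> with \<open>x\<^sub>b \<noteq> 0\<close> has its square in that span, that is, iff all
  arcs leaving such a \<open>b\<close> end in \<open>S\<close>.  Removing sinks layer by layer follows the same recursion, so
  the \<open>n\<close>-th term is the span of the first \<open>n\<close> layers.
\<close>

section \<open>Layers of sinks\<close>

definition sinks_upto :: "('v, 'e) pre_digraph \<Rightarrow> nat \<Rightarrow> 'v set" where
  "sinks_upto G n = (\<Union>i\<in>{1..n}. n_sinks G i)"

lemma sinks_upto_Suc: "sinks_upto G (Suc n) = sinks_upto G n \<union> n_sinks G (Suc n)"
  by (auto simp: sinks_upto_def atLeastAtMostSuc_conv)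

lemma (in wf_digraph) n_sinks_Suc:
  "n_sinks G (Suc n) =
     {v \<in> verts G - sinks_upto G n. \<forall>e\<in>out_arcs G v. head G e \<in> sinks_upto G n}"
proof (cases n)
  case 0
  then show ?thesis by (auto simp: sinks_upto_def sinks_def)
next
  case (Suc m)
  then have "n_sinks G (Suc n) = sinks (G \<restriction> (verts G - sinks_upto G n))"
    by (simp add: sinks_upto_def)
  then show ?thesis
    by (auto simp: sinks_def out_arcs_def induce_subgraph_def dest: head_in_verts)
qed

text \<open>
  A vertex removed earlier sends all its arcs into still earlier layers.  So the union of the layers
  satisfies a recursion that does not mention any removal of vertices.
\<close>

lemma (in wf_digraph) sinks_upto_Suc_eq:
  "sinks_upto G (Suc n) = {v \<in> verts G. \<forall>e\<in>out_arcs G v. head G e \<in> sinks_upto G n}"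
proof -
  have "sinks_upto G n \<subseteq> {v \<in> verts G. \<forall>e\<in>out_arcs G v. head G e \<in> sinks_upto G n}"
  proof (induction n)
    case 0
    show ?case by (simp add: sinks_upto_def)
  next
    case (Suc n)
    then show ?case
      unfolding sinks_upto_Suc[of _ n] n_sinks_Suc[of n] by blast
  qed
  then show ?thesis unfolding sinks_upto_Suc n_sinks_Suc by blast
qed


section \<open>Absorption and the upper annihilating series\<close>

context nonassoc_algebra
begin

text \<open>The dummy value at index \<open>0\<close> makes the recursion valid from the start.\<close>

lemma upper_annihilator_Suc:
  "upper_annihilator (Suc n) =
     {x. \<forall>a. x \<cdot> a \<in> upper_annihilator n \<and> a \<cdot> x \<in> upper_annihilator n}"
proof (cases n)
  case 0
  then show ?thesis by (auto simp: annihilator_def)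
next
  case (Suc m)
  then show ?thesis by (simp only: upper_annihilator_Suc_Suc)
qed

lemma upper_annihilator_subset_absorbing_ideal:
  assumes "algebra_ideal J" "absorption_property J"
  shows "upper_annihilator n \<subseteq> J"
proof (induction n)
  case 0
  show ?case using assms(1) by (auto simp: algebra_ideal_def subspace_0)
next
  case (Suc n)
  then show ?case
    using assms(2) unfolding upper_annihilator_Suc absorption_property_def by blast
qed

text \<open>
  The absorption property only controls products \<open>x \<cdot> a\<close>, the annihilator of a quotient both
  \<open>x \<cdot> a\<close> and \<open>a \<cdot> x\<close>; commutativity reconciles the two.
\<close>

lemma absorption_property_stable_upper_annihilator:
  assumes "\<And>x y. x \<cdot> y = y \<cdot> x"
    and "upper_annihilator q = upper_annihilator (Suc q)"
  shows "absorption_property (upper_annihilator q)"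
  unfolding absorption_property_def
proof (intro allI impI)
  fix x assume "\<forall>a. x \<cdot> a \<in> upper_annihilator q"
  then have "x \<in> upper_annihilator (Suc q)"
    by (simp only: upper_annihilator_Suc assms(1)[of _ x] mem_Collect_eq simp_thms)
  then show "x \<in> upper_annihilator q" using assms(2) by blast
qed

lemma absorption_radical_eq_stable_upper_annihilator:
  assumes "\<And>x y. x \<cdot> y = y \<cdot> x"
    and "upper_annihilator q = upper_annihilator (Suc q)"
  shows "absorption_radical = upper_annihilator q"
proof
  show "absorption_radical \<subseteq> upper_annihilator q"
    using algebra_ideal_upper_annihilator
      absorption_property_stable_upper_annihilator[OF assms]
    unfolding absorption_radical_def by blast
  show "upper_annihilator q \<subseteq> absorption_radical"
    unfolding absorption_radical_def
    using upper_annihilator_subset_absorbing_ideal by blast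
qed

lemma asi_finiteE:
  assumes "asi < \<infinity>"
  obtains q where "upper_annihilator q = upper_annihilator (Suc q)"
proof -
  have "{q. 1 \<le> q \<and> upper_annihilator q = upper_annihilator (q + 1)} \<noteq> {}"
  proof
    assume "{q. 1 \<le> q \<and> upper_annihilator q = upper_annihilator (q + 1)} = {}"
    then have "asi = \<infinity>" unfolding asi_def by (simp only: image_empty Inf_empty top_enat_def)
    with assms show False by simp
  qed
  then show ?thesis using that by auto
qed


section \<open>Evolution algebras\<close>

lemma span_scale_mem_iff: "c *s x \<in> span S \<longleftrightarrow> c = 0 \<or> x \<in> span S"
  using span_scale[of x S c] span_scale[of "c *s x" S "inverse c"]
  by (cases "c = 0") (auto simp: span_zero)

lemma mem_span_subset_basis_iff:
  assumes "independent B" "span B = UNIV" "S \<subseteq> B"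
  shows "x \<in> span S \<longleftrightarrow> (\<forall>b\<in>B. representation B x b \<noteq> 0 \<longrightarrow> b \<in> S)"
proof
  assume "x \<in> span S"
  then have "representation B x = representation S x"
    using assms by (intro representation_extend)
  then show "\<forall>b\<in>B. representation B x b \<noteq> 0 \<longrightarrow> b \<in> S"
    using representation_ne_zero[of S x] by auto
next
  assume *: "\<forall>b\<in>B. representation B x b \<noteq> 0 \<longrightarrow> b \<in> S"
  have "(\<Sum>b | representation B x b \<noteq> 0. representation B x b *s b) \<in> span S"
    using * representation_ne_zero[of B x]
    by (intro span_sum span_scale span_base) auto
  then show "x \<in> span S"
    using sum_nonzero_representation_eq[OF assms(1), of x] assms(2) by simp
qed

lemma mult_basis_vector:
  assumes "natural_basis B" "b \<in> B"
  shows "x \<cdot> b = representation B x b *s (b \<cdot> b)"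
    and "b \<cdot> x = representation B x b *s (b \<cdot> b)"
proof -
  have B: "independent B" "span B = UNIV" and
    orth: "\<And>u v. u \<in> B \<Longrightarrow> v \<in> B \<Longrightarrow> u \<noteq> v \<Longrightarrow> u \<cdot> v = 0"
    using assms(1) by (auto simp: natural_basis_def)
  have "x \<in> span B" using B by simp
  then have "x \<cdot> b = representation B x b *s (b \<cdot> b) \<and>
      b \<cdot> x = representation B x b *s (b \<cdot> b)"
  proof (induction rule: span_induct_alt)
    case base
    show ?case by (simp add: mult_simps representation_zero)
  next
    case (step c u y)
    have "representation B (c *s u + y) b = c * (if u = b then 1 else 0) + representation B y b"
      using B step(1)
      by (simp add: representation_add representation_scale representation_basis)
    then show ?case
      using step orth[OF step(1) assms(2)] orth[OF assms(2) step(1)]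
      by (auto simp: mult_simps scale_left_distrib)
  qed
  then show "x \<cdot> b = representation B x b *s (b \<cdot> b)"
    "b \<cdot> x = representation B x b *s (b \<cdot> b)" by auto
qed

lemma mult_mem_subspace_if_basis:
  assumes "subspace I" "span B = UNIV"
    and "\<And>b. b \<in> B \<Longrightarrow> x \<cdot> b \<in> I \<and> b \<cdot> x \<in> I"
  shows "x \<cdot> a \<in> I \<and> a \<cdot> x \<in> I"
proof -
  have "a \<in> span B" using assms(2) by simp
  then show ?thesis
  proof (induction rule: span_induct_alt)
    case base
    show ?case using subspace_0[OF assms(1)] by (simp add: mult_simps)
  next
    case (step c u y)
    then show ?case
      using assms(1,3) by (simp add: mult_simps subspace_add subspace_scale)
  qed
qed

lemma natural_basis_mult_commute:
  assumes "natural_basis B"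
  shows "x \<cdot> y = y \<cdot> x"
proof -
  have "y \<in> span B" using assms by (simp add: natural_basis_def)
  then show ?thesis
  proof (induction rule: span_induct_alt)
    case base
    show ?case by (simp add: mult_simps)
  next
    case (step c u y)
    then show ?case
      using mult_basis_vector[OF assms step(1), of x] by (simp add: mult_simps)
  qed
qed

lemma wf_digraph_associated_graph: "wf_digraph (associated_graph B)"
  by unfold_locales (auto simp: associated_graph_def)

lemma sinks_upto_associated_graph_Suc:
  "sinks_upto (associated_graph B) (Suc n) =
     {u \<in> B. \<forall>v\<in>B. representation B (u \<cdot> u) v \<noteq> 0 \<longrightarrow> v \<in> sinks_upto (associated_graph B) n}"
  unfolding wf_digraph.sinks_upto_Suc_eq[OF wf_digraph_associated_graph]
  by (auto simp: associated_graph_def out_arcs_def)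

lemma sinks_upto_associated_graph_subset: "sinks_upto (associated_graph B) n \<subseteq> B"
proof (cases n)
  case 0
  then show ?thesis by (simp add: sinks_upto_def)
next
  case (Suc m)
  then show ?thesis using sinks_upto_associated_graph_Suc by auto
qed

text \<open>
  Both sides obey the same recursion: a basis vector occurring in an element of the next term must
  have its square in the present term, because multiplying the element by that basis vector isolates
  a nonzero multiple of the square.
\<close>

lemma upper_annihilator_eq_span_sinks_upto:
  assumes "natural_basis B"
  shows "upper_annihilator n = span (sinks_upto (associated_graph B) n)"
proof (induction n)
  case 0
  show ?case by (simp add: sinks_upto_def)
next
  case (Suc n)
  let ?U = "sinks_upto (associated_graph B)"
  have B: "independent B" "span B = UNIV"
    using assms by (auto simp: natural_basis_def)
  note mem_span = mem_span_subset_basis_iff[OF B sinks_upto_associated_graph_subset]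
  have square: "b \<in> ?U (Suc n) \<longleftrightarrow> b \<cdot> b \<in> span (?U n)" if "b \<in> B" for b
    using that by (simp add: sinks_upto_associated_graph_Suc mem_span)
  have "x \<in> upper_annihilator (Suc n) \<longleftrightarrow> x \<in> span (?U (Suc n))" for x
  proof -
    have "x \<in> upper_annihilator (Suc n) \<longleftrightarrow>
        (\<forall>a. x \<cdot> a \<in> span (?U n) \<and> a \<cdot> x \<in> span (?U n))"
      by (simp only: upper_annihilator_Suc Suc.IH mem_Collect_eq)
    also have "\<dots> \<longleftrightarrow> (\<forall>b\<in>B. x \<cdot> b \<in> span (?U n) \<and> b \<cdot> x \<in> span (?U n))"
      using mult_mem_subspace_if_basis[OF subspace_span B(2), of x "?U n"] by blast
    also have "\<dots> \<longleftrightarrow> (\<forall>b\<in>B. representation B x b *s (b \<cdot> b) \<in> span (?U n))"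
      by (simp add: mult_basis_vector[OF assms, of _ x])
    also have "\<dots> \<longleftrightarrow> (\<forall>b\<in>B. representation B x b \<noteq> 0 \<longrightarrow> b \<in> ?U (Suc n))"
      by (auto simp: span_scale_mem_iff square)
    also have "\<dots> \<longleftrightarrow> x \<in> span (?U (Suc n))"
      by (simp only: mem_span)
    finally show ?thesis .
  qed
  then show ?case by blast
qed

text \<open>
  The layers beyond the stabilizing index contribute nothing: every term of the series lies in the
  radical, which is already the stable term.
\<close>

lemma absorption_radical_eq_span_n_sinks:
  assumes "natural_basis B" "asi < \<infinity>"
  shows "absorption_radical = span (\<Union>n\<in>{1..}. n_sinks (associated_graph B) n)"
proof
  let ?U = "sinks_upto (associated_graph B)"
  obtain q where q: "upper_annihilator q = upper_annihilator (Suc q)"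
    using assms(2) by (rule asi_finiteE)
  have comm: "\<And>x y. x \<cdot> y = y \<cdot> x" by (rule natural_basis_mult_commute[OF assms(1)])
  have rad: "absorption_radical = upper_annihilator q"
    by (rule absorption_radical_eq_stable_upper_annihilator[OF comm q])
  show "absorption_radical \<subseteq> span (\<Union>n\<in>{1..}. n_sinks (associated_graph B) n)"
    unfolding rad upper_annihilator_eq_span_sinks_upto[OF assms(1)]
    by (rule span_mono) (auto simp: sinks_upto_def)
  show "span (\<Union>n\<in>{1..}. n_sinks (associated_graph B) n) \<subseteq> absorption_radical"
  proof (rule span_minimal)
    show "subspace absorption_radical"
      using algebra_ideal_upper_annihilator[of q] by (simp add: rad algebra_ideal_def)
    show "(\<Union>n\<in>{1..}. n_sinks (associated_graph B) n) \<subseteq> absorption_radical"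
    proof (rule UN_least)
      fix n :: nat assume "n \<in> {1..}"
      then have "n_sinks (associated_graph B) n \<subseteq> ?U n"
        by (auto simp: sinks_upto_def)
      also have "\<dots> \<subseteq> upper_annihilator n"
        unfolding upper_annihilator_eq_span_sinks_upto[OF assms(1)] by (rule span_superset)
      also have "\<dots> \<subseteq> absorption_radical"
        unfolding absorption_radical_def
        using upper_annihilator_subset_absorbing_ideal by blast
      finally show "n_sinks (associated_graph B) n \<subseteq> absorption_radical" .
    qed
  qed
qed

end

theorem proposition3p23:
  fixes scale :: "'k::field \<Rightarrow> 'a::ab_group_add \<Rightarrow> 'a"
    and mult :: "'a \<Rightarrow> 'a \<Rightarrow> 'a"
    and B :: "'a set"
  assumes "nonassoc_algebra scale mult"
    and "nonassoc_algebra.natural_basis scale mult B"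
    and "nonassoc_algebra.asi scale mult < \<infinity>"
  shows "nonassoc_algebra.absorption_radical scale mult =
    module.span scale
      (\<Union>n\<in>{1..}. n_sinks (nonassoc_algebra.associated_graph scale mult B) n)"
  using assms by (rule nonassoc_algebra.absorption_radical_eq_span_n_sinks)

end
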